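(* Let $M_\lambda$ ($\lambda>0$) and $M$ be as in the context. Then $M'_{\lambda}(x)\to M'(x)$ as $\lambda\to0^+$, uniformly for $x\in(0,\infty)$, with the points $x=1,2$ excluded.
   Context: For $\lambda>0$, $M_\lambda:[0,\infty)\to\mathbb R$ is defined by $M_\lambda(x)=0$ for $0\le x\le1$ and, for all $x>0$, $M_{\lambda}(x+1)=\int_0^x\frac{\lambda e^{-\lambda t}}{1-e^{-\lambda x}}\bigl(M_{\lambda}(t)+M_{\lambda}(x-t)\bigr)\,dt+1$. This is the expected number of intervals at saturation in the exponential parking problem. $M:[0,\infty)\to\mathbb R$ is defined by $M(x)=0$ for $0\le x\le1$ and, for $x>0$, $M(x+1)=\frac2x\int_0^xM(t)\,dt+1$. This is Rényi's uniform parking expectation. Following the paper's convention, $M'_\lambda(x)=M'(x)=0$ on $(0,1)\cup(1,2)$; the derivatives do not exist at $x=1,2$. *)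

theory Defs
  imports "HOL-Analysis.Analysis"
begin

text \<open>Renyi's uniform parking expectation M: the unique function with M x = 0 for
  x \<le> 1 (the values for x < 0 are irrelevant and fixed to 0 for uniqueness) and
  M(x+1) = (2/x) * integral over [0,x] of M, plus 1, for all x > 0.\<close>
definition renyi_M :: "real \<Rightarrow> real" where
  "renyi_M = (THE f. (\<forall>x. x \<le> 1 \<longrightarrow> f x = 0) \<and>
      (\<forall>x>0. f integrable_on {0..x} \<and>
              f (x + 1) = 2 / x * integral {0..x} f + 1))"

definition exp_M :: "real \<Rightarrow> real \<Rightarrow> real" where
  "exp_M lam = (THE f. (\<forall>x. x \<le> 1 \<longrightarrow> f x = 0) \<and>
      (\<forall>x>0. (\<lambda>t. lam * exp (- lam * t) / (1 - exp (- lam * x)) * (f t + f (x - t)))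
                 integrable_on {0..x} \<and>
              f (x + 1) = integral {0..x}
                 (\<lambda>t. lam * exp (- lam * t) / (1 - exp (- lam * x)) * (f t + f (x - t))) + 1))"

end

theory Submission
  imports Defs
begin

text \<open>
  Symmetrising the exponential kernel gives, for \<open>x > 0\<close>,
  \<open>M\<^sub>\<lambda>(x + 1) = 1 + \<integral>\<^sub>0\<^sup>x (\<lambda> cosh (\<lambda>(t - x/2)) / sinh (\<lambda>x/2)) M\<^sub>\<lambda>(t) dt\<close>,
  which at \<open>\<lambda> = 0\<close> degenerates to Renyi's equation and depends continuously on \<open>(\<lambda>, x)\<close>.
  Differentiating, \<open>M\<^sub>\<lambda>'(x + 1) = R(x) / S(x)\<close> for \<open>x > 1\<close>, where, with
  \<open>s(x) = sinh (\<lambda>x) / \<lambda>\<close>, one has \<open>S' = s\<close> and, for \<open>x > 2\<close>, \<open>R'(x) = s(x) M\<^sub>\<lambda>'(x)\<close>.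
  Hence the slope satisfies the delay equation \<open>S(x) u'(x) = s(x) (u(x - 1) - u(x))\<close>, where
  \<open>u(x) = M\<^sub>\<lambda>'(x + 1)\<close>: any bounds for \<open>u\<close> on a window of length 1 persist forever.
  At \<open>\<lambda> = 0\<close> the slope is therefore bounded, so \<open>u' = O(1/x)\<close>, and \<open>u\<close> is almost
  constant on some window \<open>[X, X + 1]\<close>. By joint continuity this carries over to small \<open>\<lambda>\<close> on
  \<open>[1, X + 1]\<close>, and the persistence of bounds yields uniformity on \<open>[X, \<infinity>)\<close>.
\<close>

section \<open>The quotient \<open>sinh (l * x) / l\<close>, including \<open>l = 0\<close>\<close>

text \<open>The value at \<open>l = 0\<close> is the limit of the quotient, so that Renyi's equation
  becomes the member \<open>l = 0\<close> of a single family instead of a separate limiting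
  object.\<close>

definition sinhq :: "real \<Rightarrow> real \<Rightarrow> real" where
  "sinhq l x = (if l = 0 then x else sinh (l * x) / l)"

lemma sinhq_0 [simp]: "sinhq 0 x = x"
  by (simp add: sinhq_def)

lemma mult_sinhq: "l * sinhq l x = sinh (l * x)"
  by (simp add: sinhq_def)

lemma sinhq_pos: "0 < x \<Longrightarrow> 0 < sinhq l x"
  by (cases "0 < l") (auto simp: sinhq_def zero_less_divide_iff mult_less_0_iff)

lemma sinhq_double: "sinhq l x = 2 * sinhq l (x / 2) * cosh (l * x / 2)"
  using sinh_double[of "l * x / 2"] by (simp add: sinhq_def)

lemma cosh_sinhq_square: "(cosh (l * x))\<^sup>2 - l\<^sup>2 * (sinhq l x)\<^sup>2 = 1"
  using hyperbolic_pythagoras[of "l * x"] by (simp flip: mult_sinhq add: power_mult_distrib)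

lemma has_real_derivative_sinhq: "((\<lambda>x. sinhq l x) has_real_derivative cosh (l * x)) (at x)"
proof (cases "l = 0")
  case False
  then show ?thesis
    unfolding sinhq_def by (auto intro!: derivative_eq_intros)
qed (simp add: sinhq_def)

lemma has_real_derivative_sinhq_half:
  "((\<lambda>x. sinhq l (x / 2)) has_real_derivative cosh (l * x / 2) / 2) (at x)"
  using DERIV_chain2[OF has_real_derivative_sinhq[of l "x / 2"] DERIV_cdivide[OF DERIV_ident, of 2 x UNIV]]
  by simp

text \<open>A form without division by \<open>l\<close>: joint continuity in \<open>(l, x)\<close>,
  also across \<open>l = 0\<close>, can be read off from it.\<close>

lemma sinhq_eq_integral: "sinhq l x = x * integral {0..1} (\<lambda>r. cosh (l * x * r))"
proof (cases "l * x = 0")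
  case True
  then show ?thesis by (auto simp: sinhq_def)
next
  case False
  have "((\<lambda>r. cosh (l * x * r)) has_integral (sinh (l * x * 1) / (l * x) - sinh (l * x * 0) / (l * x))) {0..1}"
    using False
    by (intro fundamental_theorem_of_calculus)
       (auto intro!: derivative_eq_intros simp flip: has_real_derivative_iff_has_vector_derivative)
  then show ?thesis
    using False by (simp add: integral_unique sinhq_def)
qed

section \<open>Joint continuity of parameter integrals\<close>

lemma continuous_on_uncurried:
  assumes "continuous_on T (\<lambda>(x, y). F x y)" "continuous_on S f" "continuous_on S g"
    and "\<And>p. p \<in> S \<Longrightarrow> (f p, g p) \<in> T"
  shows "continuous_on S (\<lambda>p. F (f p) (g p))"
  using continuous_on_compose2[OF assms(1) continuous_on_Pair[OF assms(2,3)]] assms(4) by auto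

text \<open>Substituting \<open>t = 1 + (max 1 (b p) - 1) * r\<close> moves the integral to the
  fixed interval \<open>[0, 1]\<close>, where continuity in the parameter is standard. The
  \<open>max\<close> keeps the interval nonempty for every \<open>p\<close>.\<close>

lemma continuous_on_integral_upper:
  fixes f :: "'a::topological_space \<Rightarrow> real \<Rightarrow> real"
  assumes f: "continuous_on UNIV (\<lambda>(p, t). f p t)" and b: "continuous_on UNIV b"
  shows "continuous_on UNIV (\<lambda>p. integral {1..max 1 (b p)} (f p))"
proof -
  let ?d = "\<lambda>p. max 1 (b p) - 1"
  have "continuous_on UNIV (\<lambda>p. integral (cbox 0 1) (\<lambda>r. f p (1 + ?d p * r)))"
  proof (rule integral_continuous_on_param)
    have "continuous_on (UNIV \<times> cbox 0 1) (\<lambda>q. 1 + ?d (fst q) * snd q)"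
      by (intro continuous_intros continuous_on_compose2[OF b]) auto
    from continuous_on_uncurried[OF f continuous_on_fst[OF continuous_on_id] this]
    show "continuous_on (UNIV \<times> cbox 0 1) (\<lambda>(p, r). f p (1 + ?d p * r))"
      by (simp add: case_prod_unfold)
  qed
  moreover have "integral {1..max 1 (b p)} (f p) = ?d p * integral {0..1} (\<lambda>r. f p (1 + ?d p * r))" for p
  proof -
    have "continuous_on {1..max 1 (b p)} (f p)"
      by (rule continuous_on_uncurried[OF f]) (auto intro!: continuous_intros)
    moreover have "?d p * r \<le> ?d p" if "r \<in> {0..1}" for r
      using that by (intro mult_left_le) auto
    ultimately have "((\<lambda>r. ?d p *\<^sub>R f p (1 + ?d p * r)) has_integral
        integral {1 + ?d p * 0..1 + ?d p * 1} (f p)) {0..1}"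
      by (intro has_integral_substitution[where c=1 and d="max 1 (b p)"])
         (fastforce intro!: derivative_eq_intros)+
    then show ?thesis
      by (auto dest: integral_unique)
  qed
  ultimately show ?thesis
    by (auto intro!: continuous_intros b)
qed

lemma continuous_on_sinhq:
  assumes f: "continuous_on S f" and g: "continuous_on S g"
  shows "continuous_on S (\<lambda>p. sinhq (f p) (g p))"
proof -
  have "continuous_on S (\<lambda>p. integral (cbox 0 1) (\<lambda>r. cosh (f p * g p * r)))"
    by (rule integral_continuous_on_param)
       (auto simp: case_prod_unfold intro!: continuous_intros
         continuous_on_compose2[OF f] continuous_on_compose2[OF g])
  then show ?thesis
    unfolding sinhq_eq_integral by (auto intro!: continuous_intros g)
qed

section \<open>The symmetrised parking equation\<close>

text \<open>The right-hand side of the symmetrised equation at \<open>x = y - 1\<close>; the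
  integral starts at 1 because the expectation vanishes before. Clamping by \<open>max 1\<close>
  yields the value 1 for \<open>y \<le> 2\<close> and keeps the denominator positive, so continuity
  holds on the whole plane.\<close>

definition parking_step :: "(real \<Rightarrow> real \<Rightarrow> real) \<Rightarrow> real \<Rightarrow> real \<Rightarrow> real" where
  "parking_step F l y = 1 + integral {1..max 1 (y - 1)}
      (\<lambda>t. cosh (l * (t - max 1 (y - 1) / 2)) * F l t) / sinhq l (max 1 (y - 1) / 2)"

definition parking_iter :: "nat \<Rightarrow> real \<Rightarrow> real \<Rightarrow> real" where
  "parking_iter n = (parking_step ^^ n) (\<lambda>_ _. 1)"

text \<open>
  Unlike the parking expectation itself, which jumps at 1, this solution keeps the value 1 on
  \<open>(-\<infinity>, 2]\<close> and is continuous everywhere; \<open>\<lambda> = 0\<close> is allowed.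
\<close>
definition parking_ext :: "real \<Rightarrow> real \<Rightarrow> real" where
  "parking_ext l y = parking_iter (nat \<lceil>y\<rceil>) l y"

lemma parking_iter_Suc: "parking_iter (Suc n) = parking_step (parking_iter n)"
  by (simp add: parking_iter_def)

lemma parking_step_cong:
  assumes "\<And>t. 1 \<le> t \<Longrightarrow> t \<le> max 1 (y - 1) \<Longrightarrow> F l t = G l t"
  shows "parking_step F l y = parking_step G l y"
proof -
  have "integral {1..max 1 (y - 1)} (\<lambda>t. cosh (l * (t - max 1 (y - 1) / 2)) * F l t) =
      integral {1..max 1 (y - 1)} (\<lambda>t. cosh (l * (t - max 1 (y - 1) / 2)) * G l t)"
    using assms by (intro integral_cong) auto
  then show ?thesis
    by (simp add: parking_step_def)
qed

lemma continuous_on_parking_step: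
  assumes F: "continuous_on UNIV (\<lambda>(l, y). F l y)"
  shows "continuous_on UNIV (\<lambda>(l, y). parking_step F l y)"
proof -
  let ?x = "\<lambda>p::real \<times> real. max 1 (snd p - 1)"
  have "continuous_on UNIV (\<lambda>q::(real \<times> real) \<times> real. F (fst (fst q)) (snd q))"
    by (rule continuous_on_uncurried[OF F]) (auto intro!: continuous_intros)
  then have "continuous_on UNIV (\<lambda>p. integral {1..?x p} (\<lambda>t. cosh (fst p * (t - ?x p / 2)) * F (fst p) t))"
    by (intro continuous_on_integral_upper) (auto simp: case_prod_unfold intro!: continuous_intros)
  moreover have "sinhq (fst p) (?x p / 2) \<noteq> 0" for p :: "real \<times> real"
    by (intro less_imp_neq[THEN not_sym] sinhq_pos) auto
  ultimately show ?thesis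
    unfolding parking_step_def case_prod_unfold
    by (intro continuous_intros continuous_on_sinhq) auto
qed

lemma continuous_on_parking_iter: "continuous_on UNIV (\<lambda>(l, y). parking_iter n l y)"
proof (induction n)
  case 0
  then show ?case by (simp add: parking_iter_def case_prod_unfold)
next
  case (Suc n)
  then show ?case unfolding parking_iter_Suc by (rule continuous_on_parking_step)
qed

text \<open>A step at \<open>y\<close> reads its argument only on \<open>[1, max 1 (y - 1)]\<close>,
  so the range on which consecutive iterates agree grows by one unit per step.\<close>

lemma parking_iter_stable_Suc:
  "y \<le> real n + 1 \<Longrightarrow> parking_iter (Suc n) l y = parking_iter n l y"
proof (induction n arbitrary: y)
  case 0
  then have "max 1 (y - 1) = 1"
    by simp
  then show ?case
    by (simp add: parking_iter_def parking_step_def)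
next
  case (Suc n)
  then show ?case
    by (subst (1 2) parking_iter_Suc) (intro parking_step_cong, auto)
qed

lemma parking_iter_stable:
  assumes "n \<le> k" "y \<le> real n + 1"
  shows "parking_iter k l y = parking_iter n l y"
  using assms by (induction k rule: dec_induct) (auto simp: parking_iter_stable_Suc)

lemma parking_ext_eq_iter:
  assumes "y \<le> real n"
  shows "parking_ext l y = parking_iter n l y"
proof -
  have "nat \<lceil>y\<rceil> \<le> n" "y \<le> real (nat \<lceil>y\<rceil>) + 1"
    using assms by (auto simp: ceiling_le_iff) linarith
  then show ?thesis
    unfolding parking_ext_def by (metis parking_iter_stable)
qed

lemma parking_ext_fixpoint: "parking_step parking_ext l y = parking_ext l y"
proof -
  \<comment> \<open>The bound must also cover 1: for \<open>y \<le> 2\<close> the clamped interval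
    is the single point 1.\<close>
  obtain n :: nat where n: "max 1 y \<le> real n"
    using real_arch_simple by blast
  then have "parking_ext l y = parking_step (parking_iter n) l y"
    using parking_ext_eq_iter[of y "Suc n"] by (simp add: parking_iter_Suc)
  also have "\<dots> = parking_step parking_ext l y"
    using n by (intro parking_step_cong) (auto simp: parking_ext_eq_iter[of _ n])
  finally show ?thesis by simp
qed

text \<open>On the open strip \<open>y < n\<close> the function is the single iterate
  \<open>parking_iter n\<close>, and these strips cover the plane.\<close>

lemma continuous_on_parking_ext2: "continuous_on UNIV (\<lambda>(l, y). parking_ext l y)"
proof -
  have "continuous_on (\<Union>n. UNIV \<times> {..<real n}) (\<lambda>(l, y). parking_ext l y)"
  proof (rule continuous_on_open_UN)
    fix n :: nat
    have "continuous_on (UNIV \<times> {..<real n}) (\<lambda>(l, y). parking_iter n l y)"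
      by (rule continuous_on_subset[OF continuous_on_parking_iter]) simp
    then show "continuous_on (UNIV \<times> {..<real n}) (\<lambda>(l, y). parking_ext l y)"
      by (rule continuous_on_eq) (auto simp: parking_ext_eq_iter[of _ n])
  qed (auto intro!: open_Times)
  moreover have "(\<Union>n. UNIV \<times> {..<real n}) = (UNIV :: (real \<times> real) set)"
    by (auto intro: reals_Archimedean2)
  ultimately show ?thesis by simp
qed

lemma continuous_on_parking_ext:
  assumes "continuous_on S f" "continuous_on S g"
  shows "continuous_on S (\<lambda>p. parking_ext (f p) (g p))"
  by (rule continuous_on_uncurried[OF continuous_on_parking_ext2 assms]) auto

lemma parking_ext_eq_1: "y \<le> 2 \<Longrightarrow> parking_ext l y = 1"
  using parking_ext_fixpoint[of l y] by (simp add: parking_step_def max_absorb1)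

lemma parking_ext_shift:
  assumes "1 \<le> x"
  shows "parking_ext l (x + 1) =
    1 + integral {1..x} (\<lambda>t. cosh (l * (t - x / 2)) * parking_ext l t) / sinhq l (x / 2)"
  using parking_ext_fixpoint[of l "x + 1"] assms by (simp add: parking_step_def max_def)

section \<open>Identification with the two parking expectations\<close>

definition parking_mean :: "real \<Rightarrow> real \<Rightarrow> real" where
  "parking_mean l y = (if y \<le> 1 then 0 else parking_ext l y)"

text \<open>The integrand is 0 on \<open>[0, 1]\<close>; on \<open>[1, x]\<close> it differs from a
  continuous function only at the point 1, where \<open>parking_mean\<close> has not yet
  jumped.\<close>

lemma has_integral_parking_mean:
  assumes "0 \<le> x" and k: "continuous_on UNIV k"
  shows "((\<lambda>t. k t * parking_mean l t) has_integral
    integral {1..max 1 x} (\<lambda>t. k t * parking_ext l t)) {0..x}"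
proof (cases "x \<le> 1")
  case True
  have "((\<lambda>t. k t * parking_mean l t) has_integral 0) {0..x}"
    using True by (intro has_integral_is_0) (auto simp: parking_mean_def)
  with True show ?thesis by (simp add: max_absorb1)
next
  case False
  have "((\<lambda>t. k t * parking_mean l t) has_integral 0) {0..1}"
    by (intro has_integral_is_0) (auto simp: parking_mean_def)
  moreover have "((\<lambda>t. k t * parking_mean l t) has_integral
      integral {1..x} (\<lambda>t. k t * parking_ext l t)) {1..x}"
  proof (rule has_integral_spike_finite[of "{1}"])
    show "((\<lambda>t. k t * parking_ext l t) has_integral integral {1..x} (\<lambda>t. k t * parking_ext l t)) {1..x}"
      by (intro integrable_integral integrable_continuous_real continuous_intros
          continuous_on_parking_ext continuous_on_subset[OF k]) auto
  qed (auto simp: parking_mean_def)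
  ultimately show ?thesis
    using has_integral_combine[of 0 1 x _ 0] False by (fastforce simp: max_def)
qed

lemma parking_mean_shift:
  assumes "0 < x"
  shows "parking_mean l (x + 1) = 1 + integral {1..max 1 x}
    (\<lambda>t. cosh (l * (t - x / 2)) * parking_ext l t) / sinhq l (x / 2)"
  using assms
  by (cases "x \<le> 1") (auto simp: parking_mean_def parking_ext_eq_1 max_def parking_ext_shift)

text \<open>Method of steps: the value at \<open>x + 1\<close> is determined by the values on
  \<open>[0, x]\<close>, so agreement spreads by one unit at a time. The abstract operator
  \<open>T\<close> serves both definite descriptions.\<close>

lemma parking_solution_unique:
  fixes f g :: "real \<Rightarrow> real"
  assumes local: "\<And>x u v. 0 < x \<Longrightarrow> (\<And>t. 0 \<le> t \<Longrightarrow> t \<le> x \<Longrightarrow> u t = v t) \<Longrightarrow> T u x = T v x"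
    and f: "\<And>x. x \<le> 1 \<Longrightarrow> f x = 0" "\<And>x. 0 < x \<Longrightarrow> f (x + 1) = T f x"
    and g: "\<And>x. x \<le> 1 \<Longrightarrow> g x = 0" "\<And>x. 0 < x \<Longrightarrow> g (x + 1) = T g x"
  shows "f = g"
proof
  fix y
  have "\<forall>y \<le> real n. f y = g y" for n :: nat
  proof (induction n)
    case 0
    then show ?case by (simp add: f g)
  next
    case (Suc n)
    show ?case
    proof (intro allI impI)
      fix y assume "y \<le> real (Suc n)"
      show "f y = g y"
      proof (cases "y \<le> 1")
        case False
        with f(2)[of "y - 1"] g(2)[of "y - 1"] local[of "y - 1" f g] Suc \<open>y \<le> real (Suc n)\<close>
        show ?thesis by simp
      qed (simp add: f g)
    qed
  qed
  then show "f y = g y"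
    using real_arch_simple by blast
qed

lemma renyi_M_eq: "renyi_M = parking_mean 0"
  unfolding renyi_M_def
proof (rule the_equality)
  have int: "(parking_mean 0 has_integral integral {1..max 1 x} (parking_ext 0)) {0..x}" if "0 < x" for x
    using has_integral_parking_mean[of x "\<lambda>_. 1" 0] that by simp
  show sol: "(\<forall>x\<le>1. parking_mean 0 x = 0) \<and> (\<forall>x>0. parking_mean 0 integrable_on {0..x} \<and>
      parking_mean 0 (x + 1) = 2 / x * integral {0..x} (parking_mean 0) + 1)"
  proof (intro conjI allI impI)
    fix x :: real assume x: "0 < x"
    show "parking_mean 0 integrable_on {0..x}"
      using int[OF x] by blast
    show "parking_mean 0 (x + 1) = 2 / x * integral {0..x} (parking_mean 0) + 1"
      using parking_mean_shift[OF x, of 0] integral_unique[OF int[OF x]] by simp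
  qed (simp add: parking_mean_def)
  fix f :: "real \<Rightarrow> real"
  assume f: "(\<forall>x\<le>1. f x = 0) \<and> (\<forall>x>0. f integrable_on {0..x} \<and>
      f (x + 1) = 2 / x * integral {0..x} f + 1)"
  show "f = parking_mean 0"
  proof (rule parking_solution_unique[where T = "\<lambda>f x. 2 / x * integral {0..x} f + 1"])
    fix x :: real and u v :: "real \<Rightarrow> real"
    assume "\<And>t. 0 \<le> t \<Longrightarrow> t \<le> x \<Longrightarrow> u t = v t"
    then have "integral {0..x} u = integral {0..x} v"
      by (intro integral_cong) auto
    then show "2 / x * integral {0..x} u + 1 = 2 / x * integral {0..x} v + 1"
      by simp
  qed (use f sol in auto)
qed

text \<open>The factor \<open>2 * exp (- (l * x / 2))\<close> splits off from numerator and
  denominator and cancels, leaving \<open>cosh\<close> over \<open>sinh\<close>.\<close>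

lemma exp_kernel_eq:
  fixes l x t :: real
  assumes "0 < l" "0 < x"
  shows "l / (1 - exp (- l * x)) * (exp (- l * t) + exp (- l * (x - t))) =
    cosh (l * (t - x / 2)) / sinhq l (x / 2)"
proof -
  have e: "exp (- l * x) = exp (- (l * x / 2)) * exp (- (l * x / 2))"
      "exp (- l * t) = exp (- (l * x / 2)) * exp (- (l * (t - x / 2)))"
      "exp (- l * (x - t)) = exp (- (l * x / 2)) * exp (l * (t - x / 2))"
    by (simp_all flip: exp_add add: algebra_simps)
  have num: "exp (- l * t) + exp (- l * (x - t)) = 2 * exp (- (l * x / 2)) * cosh (l * (t - x / 2))"
    unfolding e cosh_field_def by (simp add: algebra_simps)
  have den: "1 - exp (- l * x) = 2 * exp (- (l * x / 2)) * sinh (l * x / 2)"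
    unfolding e sinh_field_def by (simp add: algebra_simps flip: exp_add)
  show ?thesis
    unfolding num den using assms by (simp add: sinhq_def field_simps)
qed

lemma has_integral_reflect_interval:
  fixes f :: "real \<Rightarrow> real"
  assumes "(f has_integral i) {0..x}"
  shows "((\<lambda>t. f (x - t)) has_integral i) {0..x}"
  using has_integral_affinity[of f i 0 x "-1" x] assms by (cases "0 \<le> x") (auto simp: algebra_simps)

lemma exp_M_eq:
  assumes l: "0 < l"
  shows "exp_M l = parking_mean l"
  unfolding exp_M_def
proof (rule the_equality)
  let ?k = "\<lambda>f x t. l * exp (- l * t) / (1 - exp (- l * x)) * (f t + f (x - t))"
  have int: "(?k (parking_mean l) x has_integral parking_mean l (x + 1) - 1) {0..x}" if x: "0 < x" for x
  proof -
    let ?c = "l / (1 - exp (- l * x))"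
    let ?I = "\<lambda>k. integral {1..max 1 x} (\<lambda>t. k t * parking_ext l t)"
    have k: "continuous_on UNIV (\<lambda>t. ?c * exp (- l * t))"
         "continuous_on UNIV (\<lambda>t. ?c * exp (- l * (x - t)))"
      by (intro continuous_intros)+
    have "((\<lambda>t. ?c * exp (- l * t) * parking_mean l t) has_integral ?I (\<lambda>t. ?c * exp (- l * t))) {0..x}"
      using has_integral_parking_mean[OF _ k(1)] x by simp
    \<comment> \<open>Reflection \<open>t \<mapsto> x - t\<close> moves the kernel from
      \<open>parking_mean l (x - t)\<close> onto \<open>parking_mean l t\<close>. The exponent is
      kept as \<open>x - (x - t)\<close>, that is \<open>t\<close>, to match the reflected
      integrand.\<close>
    moreover have "((\<lambda>t. ?c * exp (- l * (x - (x - t))) * parking_mean l (x - t)) has_integral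
        ?I (\<lambda>t. ?c * exp (- l * (x - t)))) {0..x}"
      by (rule has_integral_reflect_interval[OF has_integral_parking_mean[OF _ k(2)]]) (use x in simp)
    ultimately have "((\<lambda>t. ?c * exp (- l * t) * parking_mean l t +
         ?c * exp (- l * (x - (x - t))) * parking_mean l (x - t)) has_integral
        ?I (\<lambda>t. ?c * exp (- l * t)) + ?I (\<lambda>t. ?c * exp (- l * (x - t)))) {0..x}"
      by (rule has_integral_add)
    moreover have "?I (\<lambda>t. ?c * exp (- l * t)) + ?I (\<lambda>t. ?c * exp (- l * (x - t))) =
        integral {1..max 1 x} (\<lambda>t. ?c * exp (- l * t) * parking_ext l t +
          ?c * exp (- l * (x - t)) * parking_ext l t)"
      by (rule integral_add [symmetric])
         (intro integrable_continuous_real continuous_intros continuous_on_parking_ext)+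
    moreover have "\<dots> = integral {1..max 1 x}
        (\<lambda>t. cosh (l * (t - x / 2)) * parking_ext l t / sinhq l (x / 2))"
    proof (rule integral_cong)
      fix t
      have "?c * exp (- l * t) * parking_ext l t + ?c * exp (- l * (x - t)) * parking_ext l t =
          ?c * (exp (- l * t) + exp (- l * (x - t))) * parking_ext l t"
        by (simp only: distrib_left distrib_right)
      then show "?c * exp (- l * t) * parking_ext l t + ?c * exp (- l * (x - t)) * parking_ext l t =
          cosh (l * (t - x / 2)) * parking_ext l t / sinhq l (x / 2)"
        unfolding exp_kernel_eq[OF l x] by simp
    qed
    ultimately show ?thesis
      using parking_mean_shift[OF x, of l] by (simp add: distrib_left)
  qed
  show sol: "(\<forall>x\<le>1. parking_mean l x = 0) \<and> (\<forall>x>0. ?k (parking_mean l) x integrable_on {0..x} \<and>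
      parking_mean l (x + 1) = integral {0..x} (?k (parking_mean l) x) + 1)"
  proof (intro conjI allI impI)
    fix x :: real assume x: "0 < x"
    show "?k (parking_mean l) x integrable_on {0..x}"
      using int[OF x] by blast
    show "parking_mean l (x + 1) = integral {0..x} (?k (parking_mean l) x) + 1"
      using integral_unique[OF int[OF x]] by simp
  qed (simp add: parking_mean_def)
  fix f :: "real \<Rightarrow> real"
  assume f: "(\<forall>x\<le>1. f x = 0) \<and> (\<forall>x>0. ?k f x integrable_on {0..x} \<and>
      f (x + 1) = integral {0..x} (?k f x) + 1)"
  show "f = parking_mean l"
  proof (rule parking_solution_unique[where T = "\<lambda>f x. integral {0..x} (?k f x) + 1"])
    fix x :: real and u v :: "real \<Rightarrow> real"
    assume "\<And>t. 0 \<le> t \<Longrightarrow> t \<le> x \<Longrightarrow> u t = v t"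
    then have "integral {0..x} (?k u x) = integral {0..x} (?k v x)"
      by (intro integral_cong) auto
    then show "integral {0..x} (?k u x) + 1 = integral {0..x} (?k v x) + 1"
      by simp
  qed (use f sol in auto)
qed

section \<open>The slope and its delay equation\<close>

text \<open>This is \<open>R\<close> and \<open>slope_den\<close> is \<open>S\<close> in the opening
  outline. Integration by parts shows that it equals \<open>sinhq l 1\<close> plus the integral over
  \<open>[1, x]\<close> of \<open>sinhq l t\<close> times the slope of \<open>parking_ext l\<close>
  at \<open>t\<close>.\<close>

definition slope_num :: "real \<Rightarrow> real \<Rightarrow> real" where
  "slope_num l x = sinhq l x * parking_ext l x - integral {1..x} (\<lambda>t. cosh (l * t) * parking_ext l t)"

text \<open>Equal to \<open>(cosh (\<lambda>x) - 1) / \<lambda>\<^sup>2\<close>, and to \<open>x\<^sup>2 / 2\<close> at \<open>\<lambda> = 0\<close>.\<close>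
definition slope_den :: "real \<Rightarrow> real \<Rightarrow> real" where
  "slope_den l x = 2 * (sinhq l (x / 2))\<^sup>2"

definition parking_slope :: "real \<Rightarrow> real \<Rightarrow> real" where
  "parking_slope l x = slope_num l x / slope_den l x"

lemma slope_den_pos: "0 < x \<Longrightarrow> 0 < slope_den l x"
  using sinhq_pos[of "x / 2" l] by (simp add: slope_den_def)

lemma has_real_derivative_slope_den: "((\<lambda>x. slope_den l x) has_real_derivative sinhq l x) (at x)"
  unfolding slope_den_def
  by (rule DERIV_cong[OF DERIV_cmult[OF DERIV_power[OF has_real_derivative_sinhq_half]]])
     (simp add: sinhq_double[of l x])

lemma has_real_derivative_integral_ext:
  assumes "1 < x" and k: "continuous_on UNIV k"
  shows "((\<lambda>x. integral {1..x} (\<lambda>t. k t * parking_ext l t)) has_real_derivative k x * parking_ext l x) (at x)"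
proof -
  have "((\<lambda>x. integral {1..x} (\<lambda>t. k t * parking_ext l t)) has_real_derivative k x * parking_ext l x)
      (at x within {1..x + 1})"
    using assms
    by (intro integral_has_real_derivative continuous_intros continuous_on_parking_ext continuous_on_subset[OF k]) auto
  then show ?thesis
    using assms by (simp add: at_within_Icc_at)
qed

text \<open>The variable \<open>x\<close> occurs both in the kernel and as the upper limit. The
  subtraction formula for \<open>cosh\<close> separates \<open>x\<close> from \<open>t\<close>, so
  that only products of functions of \<open>x\<close> with the integrals \<open>?P\<close> and
  \<open>?Q\<close> have to be differentiated.\<close>

lemma has_real_derivative_parking_ext_shift:
  assumes x: "1 < x"
  shows "((\<lambda>x. parking_ext l (x + 1)) has_real_derivative parking_slope l x) (at x)"
proof -
  let ?P = "\<lambda>x. integral {1..x} (\<lambda>t. cosh (l * t) * parking_ext l t)"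
  let ?Q = "\<lambda>x. integral {1..x} (\<lambda>t. sinhq l t * parking_ext l t)"
  let ?f = "\<lambda>x. 1 + (cosh (l * x / 2) / sinhq l (x / 2)) * ?P x - l\<^sup>2 * ?Q x"
  have c: "continuous_on S (\<lambda>t. cosh (l * t))" "continuous_on S (\<lambda>t. sinhq l t)" for S
    by (intro continuous_intros continuous_on_sinhq)+
  have s: "sinhq l (x / 2) > 0" using x by (simp add: sinhq_pos)
  have split: "parking_ext l (x + 1) = ?f x" if "1 \<le> x" for x
  proof -
    have s: "sinhq l (x / 2) > 0" using that by (simp add: sinhq_pos)
    have "integral {1..x} (\<lambda>t. cosh (l * (t - x / 2)) * parking_ext l t) =
        integral {1..x} (\<lambda>t. cosh (l * x / 2) * (cosh (l * t) * parking_ext l t) -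
           l\<^sup>2 * sinhq l (x / 2) * (sinhq l t * parking_ext l t))"
    proof (rule integral_cong)
      fix t
      have "cosh (l * (t - x / 2)) = cosh (l * t) * cosh (l * x / 2) - (l * sinhq l t) * (l * sinhq l (x / 2))"
        unfolding mult_sinhq using cosh_diff[of "l * t" "l * x / 2"] by (simp add: right_diff_distrib)
      then show "cosh (l * (t - x / 2)) * parking_ext l t =
          cosh (l * x / 2) * (cosh (l * t) * parking_ext l t) -
          l\<^sup>2 * sinhq l (x / 2) * (sinhq l t * parking_ext l t)"
        by (simp only:) (simp add: algebra_simps power2_eq_square)
    qed
    also have "\<dots> = cosh (l * x / 2) * ?P x - l\<^sup>2 * sinhq l (x / 2) * ?Q x"
      by (subst integral_diff)
         (intro integrable_continuous_real continuous_intros continuous_on_parking_ext continuous_on_sinhq | simp)+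
    finally show ?thesis
      using s by (simp only: parking_ext_shift[OF that]) (simp add: diff_divide_distrib)
  qed
  have "(?f has_real_derivative
      ((cosh (l * x / 2) / sinhq l (x / 2)) * (cosh (l * x) * parking_ext l x)
       + (l\<^sup>2 * (sinhq l (x / 2))\<^sup>2 - (cosh (l * x / 2))\<^sup>2) / (2 * (sinhq l (x / 2))\<^sup>2) * ?P x
       - l\<^sup>2 * (sinhq l x * parking_ext l x))) (at x)"
  proof (rule DERIV_cong)
    have "((\<lambda>x. cosh (l * x / 2)) has_real_derivative sinh (l * x / 2) * (l / 2)) (at x)"
      by (auto intro!: derivative_eq_intros)
    from DERIV_divide[OF this has_real_derivative_sinhq_half] s
    show "(?f has_real_derivative
      0 + ((sinh (l * x / 2) * (l / 2) * sinhq l (x / 2) - cosh (l * x / 2) * (cosh (l * x / 2) / 2))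
          / (sinhq l (x / 2) * sinhq l (x / 2)) * ?P x
       + cosh (l * x) * parking_ext l x * (cosh (l * x / 2) / sinhq l (x / 2)))
       - l\<^sup>2 * (sinhq l x * parking_ext l x)) (at x)"
      by (intro DERIV_diff DERIV_add DERIV_mult DERIV_cmult DERIV_const
          has_real_derivative_integral_ext[OF x] c) auto
    have "sinh (l * x / 2) = l * sinhq l (x / 2)"
      by (simp add: mult_sinhq)
    then show "0 + ((sinh (l * x / 2) * (l / 2) * sinhq l (x / 2) - cosh (l * x / 2) * (cosh (l * x / 2) / 2))
          / (sinhq l (x / 2) * sinhq l (x / 2)) * ?P x
       + cosh (l * x) * parking_ext l x * (cosh (l * x / 2) / sinhq l (x / 2)))
       - l\<^sup>2 * (sinhq l x * parking_ext l x) =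
      (cosh (l * x / 2) / sinhq l (x / 2)) * (cosh (l * x) * parking_ext l x)
       + (l\<^sup>2 * (sinhq l (x / 2))\<^sup>2 - (cosh (l * x / 2))\<^sup>2) / (2 * (sinhq l (x / 2))\<^sup>2) * ?P x
       - l\<^sup>2 * (sinhq l x * parking_ext l x)"
      using s by (simp add: field_simps power2_eq_square)
  qed
  moreover have "cosh (l * x / 2) / sinhq l (x / 2) * (cosh (l * x) * parking_ext l x)
       + (l\<^sup>2 * (sinhq l (x / 2))\<^sup>2 - (cosh (l * x / 2))\<^sup>2) / (2 * (sinhq l (x / 2))\<^sup>2) * ?P x
       - l\<^sup>2 * (sinhq l x * parking_ext l x) = parking_slope l x"
  proof -
    \<comment> \<open>Two identities collapse the derivative: this one makes the coefficient of
      \<open>?P x\<close> equal to \<open>-1 / slope_den l x\<close>, and the subtraction formula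
      below makes that of \<open>parking_ext l x\<close> equal to
      \<open>sinhq l x / slope_den l x\<close>.\<close>
    have sq: "l\<^sup>2 * (sinhq l (x / 2))\<^sup>2 - (cosh (l * x / 2))\<^sup>2 = -1"
      using cosh_sinhq_square[of l "x / 2"] by simp
    have "cosh (l * x / 2) * cosh (l * x) - l\<^sup>2 * sinhq l x * sinhq l (x / 2) = cosh (l * x / 2)"
    proof -
      have "l\<^sup>2 * sinhq l x * sinhq l (x / 2) = sinh (l * x) * sinh (l * x / 2)"
        using mult_sinhq[of l x] mult_sinhq[of l "x / 2"] by (simp add: power2_eq_square mult_ac)
      then show ?thesis
        using cosh_diff[of "l * x" "l * x / 2"] by (simp add: mult.commute)
    qed
    then have "cosh (l * x / 2) / sinhq l (x / 2) * cosh (l * x) - l\<^sup>2 * sinhq l x = sinhq l x / slope_den l x"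
      using s by (simp add: slope_den_def sinhq_double[of l x] field_simps power2_eq_square)
    note coeff = this
    have "cosh (l * x / 2) / sinhq l (x / 2) * (cosh (l * x) * parking_ext l x) + -1 / (2 * (sinhq l (x / 2))\<^sup>2) * ?P x
        - l\<^sup>2 * (sinhq l x * parking_ext l x) =
        (cosh (l * x / 2) / sinhq l (x / 2) * cosh (l * x) - l\<^sup>2 * sinhq l x) * parking_ext l x - ?P x / slope_den l x"
      by (simp add: slope_den_def left_diff_distrib)
    also have "\<dots> = parking_slope l x"
      unfolding coeff by (simp add: parking_slope_def slope_num_def diff_divide_distrib)
    finally show ?thesis
      unfolding sq .
  qed
  ultimately have "(?f has_real_derivative parking_slope l x) (at x)"
    by simp
  then show ?thesis
    by (rule has_field_derivative_transform_within_open[where S="{1<..}"]) (use x split in auto)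
qed

lemma has_real_derivative_parking_ext:
  assumes "2 < y"
  shows "((\<lambda>y. parking_ext l y) has_real_derivative parking_slope l (y - 1)) (at y)"
proof -
  have "((\<lambda>y. parking_ext l (y - 1 + 1)) has_real_derivative parking_slope l (y - 1) * 1) (at y)"
    using has_real_derivative_parking_ext_shift[of "y - 1" l] assms
    by (intro DERIV_chain2[of "\<lambda>x. parking_ext l (x + 1)" _ "\<lambda>y. y - 1"]) (auto intro!: derivative_eq_intros)
  then show ?thesis
    by simp
qed

text \<open>The product-rule term \<open>cosh (l * x) * parking_ext l x\<close> cancels against the
  derivative of the integral; what remains is the slope one unit earlier, which is the source of the
  delay.\<close>

lemma has_real_derivative_slope_num:
  assumes x: "2 < x"
  shows "((\<lambda>x. slope_num l x) has_real_derivative sinhq l x * parking_slope l (x - 1)) (at x)"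
proof -
  have c: "continuous_on UNIV (\<lambda>t. cosh (l * t))"
    by (intro continuous_intros)
  show ?thesis
    unfolding slope_num_def
    using x
    by (intro DERIV_cong[OF DERIV_diff[OF DERIV_mult[OF has_real_derivative_sinhq has_real_derivative_parking_ext]
          has_real_derivative_integral_ext[OF _ c]]]) auto
qed

section \<open>Joint continuity of the slope and persistence of its bounds\<close>

lemma continuous_on_slope_num2: "continuous_on (UNIV \<times> {1..}) (\<lambda>(l, x). slope_num l x)"
proof -
  have "continuous_on UNIV (\<lambda>q::(real \<times> real) \<times> real. cosh (fst (fst q) * snd q) * parking_ext (fst (fst q)) (snd q))"
    by (intro continuous_intros continuous_on_parking_ext)
  then have "continuous_on UNIV (\<lambda>p::real\<times>real. integral {1..max 1 (snd p)} (\<lambda>t. cosh (fst p * t) * parking_ext (fst p) t))"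
    by (intro continuous_on_integral_upper) (auto simp: case_prod_unfold intro!: continuous_intros)
  then have "continuous_on UNIV (\<lambda>p::real\<times>real. sinhq (fst p) (snd p) * parking_ext (fst p) (snd p)
     - integral {1..max 1 (snd p)} (\<lambda>t. cosh (fst p * t) * parking_ext (fst p) t))"
    by (intro continuous_intros continuous_on_parking_ext continuous_on_sinhq)
  then have "continuous_on (UNIV \<times> {1..}) (\<lambda>p::real\<times>real. sinhq (fst p) (snd p) * parking_ext (fst p) (snd p)
     - integral {1..max 1 (snd p)} (\<lambda>t. cosh (fst p * t) * parking_ext (fst p) t))"
    by (rule continuous_on_subset) simp
  then show ?thesis
    by (rule continuous_on_eq) (auto simp: slope_num_def max_def)
qed

lemma continuous_on_parking_slope2: "continuous_on (UNIV \<times> {1..}) (\<lambda>(l, x). parking_slope l x)"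
proof -
  have "continuous_on (UNIV \<times> {1..}) (\<lambda>p::real\<times>real. slope_num (fst p) (snd p))"
    using continuous_on_slope_num2 by (simp add: case_prod_unfold)
  moreover have "continuous_on (UNIV \<times> {1..}) (\<lambda>p::real\<times>real. slope_den (fst p) (snd p))"
    unfolding slope_den_def by (intro continuous_intros continuous_on_sinhq) auto
  ultimately have "continuous_on (UNIV \<times> {1..}) (\<lambda>p::real\<times>real. slope_num (fst p) (snd p) / slope_den (fst p) (snd p))"
    by (rule continuous_on_divide) (auto intro!: less_imp_neq[THEN not_sym] slope_den_pos)
  then show ?thesis
    by (simp add: case_prod_unfold parking_slope_def)
qed

text \<open>
  With \<open>E = a R + b S\<close>, the delay equation reads \<open>E'(x) = s(x) E(x - 1) / S(x - 1)\<close>, so \<open>E\<close> cannot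
  decrease one unit after it was nonnegative.
\<close>
lemma slope_comparison:
  assumes X: "1 \<le> X"
    and window: "\<And>x. X \<le> x \<Longrightarrow> x \<le> X + 1 \<Longrightarrow> 0 \<le> a * parking_slope l x + b"
    and x: "X \<le> x"
  shows "0 \<le> a * parking_slope l x + b"
proof -
  define E where "E x = a * slope_num l x + b * slope_den l x" for x
  have E_eq: "E x = slope_den l x * (a * parking_slope l x + b)" if "1 \<le> x" for x
    using slope_den_pos[of x l] that by (simp add: E_def parking_slope_def field_simps)
  have iff: "0 \<le> E x \<longleftrightarrow> 0 \<le> a * parking_slope l x + b" if "1 \<le> x" for x
    using slope_den_pos[of x l] that by (simp add: E_eq zero_le_mult_iff)
  have cont: "continuous_on {c..d} E" if "1 \<le> c" for c d
  proof -
    have "continuous_on {c..d} (\<lambda>x. slope_num l x)"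
      by (rule continuous_on_uncurried[OF continuous_on_slope_num2]) (use that in \<open>auto intro!: continuous_intros\<close>)
    moreover have "continuous_on {c..d} (\<lambda>x. slope_den l x)"
      unfolding slope_den_def by (intro continuous_intros continuous_on_sinhq) auto
    ultimately show ?thesis
      unfolding E_def by (intro continuous_intros)
  qed
  \<comment> \<open>Induction over unit intervals: \<open>window\<close> is the case
    \<open>n = 0\<close>, and on each further interval \<open>E\<close> is nondecreasing by the
    bound on the interval before it.\<close>
  have "\<forall>y. X \<le> y \<longrightarrow> y \<le> X + real (Suc n) \<longrightarrow> 0 \<le> a * parking_slope l y + b" for n
  proof (induction n)
    case 0
    then show ?case using window by simp
  next
    case (Suc n)
    show ?case
    proof (intro allI impI)
      fix y assume y: "X \<le> y" "y \<le> X + real (Suc (Suc n))"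
      let ?c = "X + real (Suc n)"
      show "0 \<le> a * parking_slope l y + b"
      proof (cases "y \<le> ?c")
        case False
        have "E ?c \<le> E y"
        proof (rule DERIV_nonneg_imp_increasing_open[where f = E])
          fix z assume z: "?c < z" "z < y"
          have "(E has_real_derivative a * (sinhq l z * parking_slope l (z - 1)) + b * sinhq l z) (at z)"
            unfolding E_def
            by (intro DERIV_add DERIV_cmult has_real_derivative_slope_num has_real_derivative_slope_den)
               (use z X in simp)
          moreover have "a * (sinhq l z * parking_slope l (z - 1)) + b * sinhq l z =
              sinhq l z * (a * parking_slope l (z - 1) + b)"
            by (simp add: algebra_simps)
          moreover have "0 \<le> a * parking_slope l (z - 1) + b"
            using Suc z y by auto
          moreover have "0 \<le> sinhq l z"
            using z X by (intro less_imp_le sinhq_pos) auto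
          ultimately show "\<exists>d. (E has_real_derivative d) (at z) \<and> 0 \<le> d"
            by auto
        qed (use False X cont in auto)
        moreover have "0 \<le> E ?c"
          using Suc X by (simp add: iff)
        ultimately show ?thesis
          using iff[of y] y X by simp
      qed (use Suc y in auto)
    qed
  qed
  moreover obtain n :: nat where "x - X \<le> real n"
    using real_arch_simple by blast
  ultimately show ?thesis
    using x by (smt (verit) of_nat_Suc)
qed

text \<open>The lower and the upper bound are the comparison with \<open>a = 1\<close> and with
  \<open>a = -1\<close>.\<close>

lemma slope_window_bound:
  assumes X: "1 \<le> X"
    and window: "\<And>x. X \<le> x \<Longrightarrow> x \<le> X + 1 \<Longrightarrow> \<bar>parking_slope l x - c\<bar> \<le> d"
    and x: "X \<le> x"
  shows "\<bar>parking_slope l x - c\<bar> \<le> d"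
proof -
  have "0 \<le> 1 * parking_slope l x + (d - c)"
    by (rule slope_comparison[OF X _ x]) (use window in force)
  moreover have "0 \<le> (-1) * parking_slope l x + (d + c)"
    by (rule slope_comparison[OF X _ x]) (use window in force)
  ultimately show ?thesis by simp
qed

section \<open>Behaviour of Renyi's slope and uniform convergence\<close>

text \<open>Compactness gives a bound on the window \<open>[1, 2]\<close>, and window bounds
  persist.\<close>

lemma slope_0_bounded:
  obtains K where "\<And>x. 1 \<le> x \<Longrightarrow> \<bar>parking_slope 0 x\<bar> \<le> K"
proof -
  have "continuous_on {1..2} (parking_slope 0)"
    by (rule continuous_on_uncurried[OF continuous_on_parking_slope2]) (auto intro!: continuous_intros)
  then have "bounded (parking_slope 0 ` {1..2})"
    by (intro compact_imp_bounded compact_continuous_image) auto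
  then obtain K where *: "\<forall>y \<in> parking_slope 0 ` {1..2}. norm y \<le> K"
    unfolding bounded_iff by blast
  have "\<bar>parking_slope 0 x - 0\<bar> \<le> K" if "1 \<le> x" for x
    by (rule slope_window_bound[OF order_refl _ that]) (use * in auto)
  then show ?thesis
    using that[of K] by simp
qed

text \<open>At \<open>l = 0\<close> the delay equation reads
  \<open>g'(x) = 2 / x * (g (x - 1) - g x)\<close>. With \<open>g\<close> bounded by
  \<open>K\<close>, the derivative is at most \<open>4 * K / x\<close> in absolute value, hence
  small on a distant unit window.\<close>

lemma slope_0_small_oscillation:
  assumes d: "0 < d"
  obtains X where "3 \<le> X" "\<And>x. X \<le> x \<Longrightarrow> x \<le> X + 1 \<Longrightarrow> \<bar>parking_slope 0 x - parking_slope 0 X\<bar> \<le> d"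
proof -
  let ?g = "parking_slope 0"
  obtain K where K: "\<And>x. 1 \<le> x \<Longrightarrow> \<bar>?g x\<bar> \<le> K"
    using slope_0_bounded by blast
  \<comment> \<open>The term \<open>4 * K / d\<close> makes the derivative bound at most
    \<open>d\<close>; the 3 keeps all points above 2, where the delay equation holds.\<close>
  define X where "X = max 3 (4 * K / d)"
  have "0 \<le> K" using K[of 1] by simp
  have X: "3 \<le> X" "4 * K / X \<le> d"
    using d by (auto simp: X_def field_simps max_def)
  have deriv: "(?g has_real_derivative 2 / x * (?g (x - 1) - ?g x)) (at x)" if "2 < x" for x
  proof -
    have "((\<lambda>x. slope_num 0 x / slope_den 0 x) has_real_derivative 2 / x * (?g (x - 1) - ?g x)) (at x)"
    proof (rule DERIV_cong[OF DERIV_divide[OF has_real_derivative_slope_num has_real_derivative_slope_den]])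
      show "(sinhq 0 x * ?g (x - 1) * slope_den 0 x - slope_num 0 x * sinhq 0 x) / (slope_den 0 x * slope_den 0 x) =
          2 / x * (?g (x - 1) - ?g x)"
        using that by (simp add: parking_slope_def[of 0 x] slope_den_def[of 0 x] field_simps power2_eq_square)
    qed (use that slope_den_pos[of x 0] in auto)
    then show ?thesis
      by (simp add: parking_slope_def[abs_def])
  qed
  have "\<bar>?g x - ?g X\<bar> \<le> d" if x: "X \<le> x" "x \<le> X + 1" for x
  proof (cases "x = X")
    case False
    then obtain z where z: "X < z" "z < x" "?g x - ?g X = (x - X) * (2 / z * (?g (z - 1) - ?g z))"
      using MVT2[of X x ?g "\<lambda>x. 2 / x * (?g (x - 1) - ?g x)"] deriv x X by auto
    have "\<bar>?g (z - 1) - ?g z\<bar> \<le> 2 * K"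
      using K[of "z - 1"] K[of z] z X by auto
    then have "\<bar>?g x - ?g X\<bar> \<le> 1 * (2 / X * (2 * K))"
      unfolding z(3) abs_mult
      using x z X \<open>0 \<le> K\<close> by (intro mult_mono) (auto intro!: divide_left_mono)
    then show ?thesis using X by simp
  qed (use d in simp)
  with X(1) show ?thesis by (rule that)
qed

lemma parking_slope_uniform: "uniform_limit {1..} parking_slope (parking_slope 0) (at_right 0)"
proof (rule uniform_limitI)
  fix e :: real assume "0 < e"
  \<comment> \<open>Beyond \<open>X + 1\<close> the errors are \<open>2 * d\<close> for the slope at
    \<open>l\<close> and \<open>d\<close> for the slope at 0, in total
    \<open>3 * d < e\<close>.\<close>
  define d where "d = e / 4"
  have d: "0 < d" "3 * d < e" using \<open>0 < e\<close> by (auto simp: d_def)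
  obtain X where X: "3 \<le> X" and osc: "\<And>x. X \<le> x \<Longrightarrow> x \<le> X + 1 \<Longrightarrow> \<bar>parking_slope 0 x - parking_slope 0 X\<bar> \<le> d"
    using slope_0_small_oscillation[OF d(1)] by blast
  \<comment> \<open>This compact box contains \<open>l = 0\<close> and reaches over the whole window
    \<open>[X, X + 1]\<close>, so one \<open>h\<close> controls everything up to the end of the
    window.\<close>
  let ?B = "{0..1} \<times> {1..X + 1}"
  have "uniformly_continuous_on ?B (\<lambda>(l, x). parking_slope l x)"
    by (intro compact_uniformly_continuous continuous_on_subset[OF continuous_on_parking_slope2] compact_Times) auto
  then obtain h where h: "0 < h" and
    close: "\<And>p q. p \<in> ?B \<Longrightarrow> q \<in> ?B \<Longrightarrow> dist q p < h \<Longrightarrow>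
      dist ((\<lambda>(l, x). parking_slope l x) q) ((\<lambda>(l, x). parking_slope l x) p) < d"
    using d(1) unfolding uniformly_continuous_on_def by metis
  have "\<bar>parking_slope l x - parking_slope 0 x\<bar> < e" if l: "0 < l" "l < min h 1" and x: "1 \<le> x" for l x
  proof -
    have near: "\<bar>parking_slope l y - parking_slope 0 y\<bar> < d" if "1 \<le> y" "y \<le> X + 1" for y
      using close[of "(0, y)" "(l, y)"] l that by (simp add: dist_Pair_Pair dist_real_def)
    show ?thesis
    proof (cases "x \<le> X + 1")
      case False
      \<comment> \<open>Both slopes are compared with the constant \<open>parking_slope 0 X\<close>,
        since bounds around a constant are what persists to the right of the window.\<close>
      have "\<bar>parking_slope l y - parking_slope 0 X\<bar> \<le> 2 * d" if "X \<le> y" "y \<le> X + 1" for y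
        using near[of y] osc[of y] that X by linarith
      then have "\<bar>parking_slope l x - parking_slope 0 X\<bar> \<le> 2 * d"
        by (rule slope_window_bound[rotated]) (use X False in auto)
      moreover have "\<bar>parking_slope 0 x - parking_slope 0 X\<bar> \<le> d"
        by (rule slope_window_bound[of X]) (use X False osc in auto)
      ultimately show ?thesis using d by linarith
    qed (use near[of x] x d in auto)
  qed
  moreover have "\<forall>\<^sub>F l in at_right (0::real). 0 < l \<and> l < min h 1"
    using h by (auto simp: eventually_at_right_field intro!: exI[of _ "min h 1"])
  ultimately show "\<forall>\<^sub>F l in at_right 0. \<forall>x\<in>{1..}. dist (parking_slope l x) (parking_slope 0 x) < e"
    by (auto simp: dist_real_def elim!: eventually_mono)
qed

section \<open>Transfer to the derivatives of the expectations\<close>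

text \<open>It covers both families at once, as \<open>l = 0\<close> is allowed. Below 2 the
  function is locally constant away from the jump at 1; above 2 the argument \<open>y - 1\<close>
  exceeds 1 and so lies in the range of \<open>parking_slope_uniform\<close>.\<close>

lemma deriv_parking_mean:
  assumes "y \<in> {0<..} - {1, 2}"
  shows "deriv (parking_mean l) y = (if y < 2 then 0 else parking_slope l (y - 1))"
proof -
  consider "y < 1" | "1 < y" "y < 2" | "2 < y"
    using assms by fastforce
  then show ?thesis
  proof cases
    case 1
    have "((\<lambda>_. 0) has_real_derivative 0) (at y)" by simp
    then have "(parking_mean l has_real_derivative 0) (at y)"
      by (rule has_field_derivative_transform_within_open[where S="{..<1}"]) (use 1 in \<open>auto simp: parking_mean_def\<close>)
    then show ?thesis using 1 by (simp add: DERIV_imp_deriv)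
  next
    case 2
    have "((\<lambda>_. 1) has_real_derivative 0) (at y)" by simp
    then have "(parking_mean l has_real_derivative 0) (at y)"
      by (rule has_field_derivative_transform_within_open[where S="{1<..<2}"])
         (use 2 in \<open>auto simp: parking_mean_def parking_ext_eq_1\<close>)
    then show ?thesis using 2 by (simp add: DERIV_imp_deriv)
  next
    case 3
    from has_real_derivative_parking_ext[OF 3]
    have "(parking_mean l has_real_derivative parking_slope l (y - 1)) (at y)"
      by (rule has_field_derivative_transform_within_open[where S="{2<..}"]) (use 3 in \<open>auto simp: parking_mean_def\<close>)
    then show ?thesis using 3 by (simp add: DERIV_imp_deriv)
  qed
qed

theorem theorem2:
  shows "uniform_limit ({0<..} - {1, 2}) (\<lambda>lam x. deriv (exp_M lam) x) (deriv renyi_M)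
           (at_right 0)"
proof (rule uniform_limitI)
  fix e :: real assume "0 < e"
  \<comment> \<open>Positivity of \<open>l\<close> is what \<open>exp_M_eq\<close> requires, and it
    holds eventually at the right of 0.\<close>
  have "\<forall>\<^sub>F l in at_right (0::real). 0 < l"
    by (simp add: eventually_at_right_less)
  with uniform_limitD[OF parking_slope_uniform \<open>0 < e\<close>]
  show "\<forall>\<^sub>F l in at_right 0. \<forall>x\<in>{0<..} - {1, 2}. dist (deriv (exp_M l) x) (deriv renyi_M x) < e"
    by eventually_elim (use \<open>0 < e\<close> in \<open>auto simp: exp_M_eq renyi_M_eq deriv_parking_mean\<close>)
qed

end
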